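(* Let $\varrho$ be a state acting on the Hilbert space $\mathbb{C}^2\otimes\mathbb{C}^2$. Then $$\mathcal{M}(\varrho)\leq 1-S(\varrho).$$
   Context: A state is a density matrix; $S(\varrho)=-\mathrm{Tr}\,\varrho\log_2\varrho$ is the von Neumann entropy. $\mathcal{PS}$ denotes the set of product states $\varrho_A\otimes\varrho_B$. A von Neumann measurement $\mathcal{P}=\{P_i\}$ is a complete family of mutually orthogonal rank-one projectors on $\mathbb{C}^2\otimes\mathbb{C}^2$ (not necessarily of product form) summing to the identity. The Klein entropy is $H(\varrho,\mathcal{P})=-\sum_i p_i\log_2 p_i$ with $p_i=\mathrm{Tr}(\varrho P_i)$ and $0\log_2 0=0$. The entropic entanglement parameter is $$\mathcal{M}(\varrho)=\sup_{\mathcal{P}}\Big(\inf_{\delta\in\mathcal{PS}}H(\delta,\mathcal{P})-H(\varrho,\mathcal{P})\Big),$$ the supremum being over all von Neumann measurements. *)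

theory Defs
  imports "HOL-Analysis.Analysis"
begin

definition dagger :: "complex^'n^'m \<Rightarrow> complex^'m^'n" where
  "dagger A = (\<chi> i j. cnj (A $ j $ i))"

definition hermitian :: "complex^'n^'n \<Rightarrow> bool" where
  "hermitian A \<longleftrightarrow> dagger A = A"

definition unitary :: "complex^'n^'n \<Rightarrow> bool" where
  "unitary U \<longleftrightarrow> dagger U ** U = mat 1 \<and> U ** dagger U = mat 1"

definition cinner :: "complex^'n \<Rightarrow> complex^'n \<Rightarrow> complex" where
  "cinner x y = (\<Sum>i\<in>UNIV. cnj (x $ i) * y $ i)"

definition pos_semidef :: "complex^'n^'n \<Rightarrow> bool" where
  "pos_semidef A \<longleftrightarrow> hermitian A \<and> (\<forall>x. 0 \<le> Re (cinner x (A *v x)))"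

definition diag_real :: "('n \<Rightarrow> real) \<Rightarrow> complex^'n^'n" where
  "diag_real d = (\<chi> i j. if i = j then complex_of_real (d i) else 0)"

text \<open>Functional calculus for Hermitian matrices: \<open>f\<close> is applied to the eigenvalues in a
  spectral decomposition.  The result does not depend on the decomposition, see
  \<open>matrix_fun_eq\<close> below.\<close>

definition matrix_fun :: "(real \<Rightarrow> real) \<Rightarrow> complex^'n^'n \<Rightarrow> complex^'n^'n" where
  "matrix_fun f A = (THE B. \<exists>U d. unitary U \<and> A = U ** diag_real d ** dagger U \<and>
     B = U ** diag_real (\<lambda>i. f (d i)) ** dagger U)"

lemma diag_real_mult_left: "(diag_real d ** A) $ i $ j = complex_of_real (d i) * A $ i $ j"
  by (simp add: matrix_matrix_mult_def diag_real_def if_distrib[of "\<lambda>x. x * _"] cong: if_cong)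

lemma diag_real_mult_right: "(A ** diag_real d) $ i $ j = A $ i $ j * complex_of_real (d j)"
  by (simp add: matrix_matrix_mult_def diag_real_def if_distrib[of "\<lambda>x. _ * x"] cong: if_cong)

lemma spectral_decomposition_fun_unique:
  assumes U: "unitary U" and V: "unitary V"
    and eq: "U ** diag_real d ** dagger U = V ** diag_real e ** dagger V"
  shows "U ** diag_real (\<lambda>i. f (d i)) ** dagger U = V ** diag_real (\<lambda>i. f (e i)) ** dagger V"
proof -
  define W where "W = dagger V ** U"
  have U1: "dagger U ** U = mat 1" "U ** dagger U = mat 1"
    and V1: "dagger V ** V = mat 1" "V ** dagger V = mat 1"
    using U V by (auto simp: unitary_def)
  have "W ** diag_real d = dagger V ** (U ** diag_real d ** dagger U) ** U"
    by (simp add: W_def matrix_mul_assoc[symmetric] U1)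
  also have "\<dots> = (dagger V ** V) ** diag_real e ** (dagger V ** U)"
    unfolding eq by (simp add: matrix_mul_assoc)
  also have "\<dots> = diag_real e ** W" by (simp add: V1 W_def)
  finally have WE: "W ** diag_real d = diag_real e ** W" .
  have "W $ i $ j * complex_of_real (f (d j)) = complex_of_real (f (e i)) * W $ i $ j" for i j
  proof (cases "W $ i $ j = 0")
    case False
    have "W $ i $ j * complex_of_real (d j) = complex_of_real (e i) * W $ i $ j"
      using WE diag_real_mult_left diag_real_mult_right by metis
    then have "d j = e i" using False by simp
    then show ?thesis by simp
  qed simp
  then have WF: "W ** diag_real (\<lambda>i. f (d i)) = diag_real (\<lambda>i. f (e i)) ** W"
    by (simp add: vec_eq_iff diag_real_mult_left diag_real_mult_right)
  have VW: "V ** W = U"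
    by (simp add: W_def matrix_mul_assoc V1)
  have WU: "W ** dagger U = dagger V"
    by (simp add: W_def matrix_mul_assoc[symmetric] U1)
  have "U ** diag_real (\<lambda>i. f (d i)) ** dagger U
      = V ** (W ** diag_real (\<lambda>i. f (d i))) ** dagger U"
    by (simp add: matrix_mul_assoc VW)
  also have "\<dots> = V ** diag_real (\<lambda>i. f (e i)) ** (W ** dagger U)"
    unfolding WF by (simp add: matrix_mul_assoc)
  finally show ?thesis unfolding WU .
qed

lemma matrix_fun_eq:
  assumes "unitary U" and "A = U ** diag_real d ** dagger U"
  shows "matrix_fun f A = U ** diag_real (\<lambda>i. f (d i)) ** dagger U"
  unfolding matrix_fun_def
proof (rule the_equality)
  show "\<exists>V e. unitary V \<and> A = V ** diag_real e ** dagger V \<and>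
      U ** diag_real (\<lambda>i. f (d i)) ** dagger U = V ** diag_real (\<lambda>i. f (e i)) ** dagger V"
    using assms by blast
next
  fix B
  assume "\<exists>V e. unitary V \<and> A = V ** diag_real e ** dagger V \<and>
      B = V ** diag_real (\<lambda>i. f (e i)) ** dagger V"
  then show "B = U ** diag_real (\<lambda>i. f (d i)) ** dagger U"
    using assms spectral_decomposition_fun_unique by metis
qed

definition density_matrix :: "complex^'n^'n \<Rightarrow> bool" where
  "density_matrix \<rho> \<longleftrightarrow> pos_semidef \<rho> \<and> trace \<rho> = 1"

text \<open>The real function \<open>log 2\<close> is total; the value it takes at the eigenvalue \<open>0\<close> is
  annihilated by the factor \<open>\<rho>\<close>, which gives the convention \<open>0 log 0 = 0\<close>.\<close>

definition von_neumann_entropy :: "complex^'n^'n \<Rightarrow> real" where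
  "von_neumann_entropy \<rho> = - Re (trace (\<rho> ** matrix_fun (log 2) \<rho>))"

text \<open>The space \<open>\<complex>\<^sup>a \<otimes> \<complex>\<^sup>b\<close> is \<open>complex^('a \<times> 'b)\<close>, the pair \<open>(i, j)\<close> indexing
  the product basis vector \<open>e\<^sub>i \<otimes> e\<^sub>j\<close>.\<close>

definition mat_tensor ::
  "complex^'a::finite^'a \<Rightarrow> complex^'b::finite^'b \<Rightarrow> complex^('a \<times> 'b)^('a \<times> 'b)" where
  "mat_tensor A B = (\<chi> i j. A $ fst i $ fst j * B $ snd i $ snd j)"

definition product_states :: "(complex^('a::finite \<times> 'b::finite)^('a \<times> 'b)) set" where
  "product_states = {mat_tensor \<rho>A \<rho>B | \<rho>A \<rho>B. density_matrix \<rho>A \<and> density_matrix \<rho>B}"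

definition rank_one_projector :: "complex^'n^'n \<Rightarrow> bool" where
  "rank_one_projector P \<longleftrightarrow> hermitian P \<and> P ** P = P \<and> rank P = 1"

definition von_neumann_measurement :: "(complex^'n^'n) set \<Rightarrow> bool" where
  "von_neumann_measurement \<P> \<longleftrightarrow> finite \<P> \<and> (\<forall>P\<in>\<P>. rank_one_projector P) \<and>
     (\<forall>P\<in>\<P>. \<forall>Q\<in>\<P>. P \<noteq> Q \<longrightarrow> P ** Q = 0) \<and> (\<Sum>P\<in>\<P>. P) = mat 1"

definition outcome_prob :: "complex^'n^'n \<Rightarrow> complex^'n^'n \<Rightarrow> real" where
  "outcome_prob \<rho> P = Re (trace (\<rho> ** P))"

definition klein_entropy :: "complex^'n^'n \<Rightarrow> (complex^'n^'n) set \<Rightarrow> real" where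
  "klein_entropy \<rho> \<P> = - (\<Sum>P\<in>\<P>. outcome_prob \<rho> P * log 2 (outcome_prob \<rho> P))"

text \<open>Supremum and infimum are taken in the reals: the sets are nonempty, and Klein entropies of
  states lie in \<open>[0, 2]\<close>, so both are proper.\<close>

definition entropic_entanglement :: "complex^(2 \<times> 2)^(2 \<times> 2) \<Rightarrow> real" where
  "entropic_entanglement \<rho> =
     (SUP \<P>\<in>{\<P>. von_neumann_measurement \<P>}.
        (INF \<delta>\<in>product_states. klein_entropy \<delta> \<P>) - klein_entropy \<rho> \<P>)"

end

theory Submission
  imports Defs
begin

text \<open>The outcome distribution of any von Neumann measurement is the image of the spectrum of
  \<open>\<rho>\<close> under a doubly stochastic matrix, so convexity of \<open>x log x\<close> gives \<open>S(\<rho>) \<le> H(\<rho>, \<P>)\<close>.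
  On the other hand every two-dimensional subspace of \<open>\<complex>\<^sup>2 \<otimes> \<complex>\<^sup>2\<close> contains a product vector,
  because the determinant of the coefficient matrix has a zero on it.  Applied to the span of two
  vectors of the measurement basis, this yields a product state with at most two possible
  outcomes, hence with Klein entropy at most \<open>1\<close>.\<close>

section \<open>Spectral theorem for Hermitian matrices\<close>

lemma cinner_zero_right [simp]: "cinner x 0 = 0"
  by (simp add: cinner_def)

lemma cinner_add_right: "cinner x (y + z) = cinner x y + cinner x z"
  by (simp add: cinner_def algebra_simps sum.distrib)

lemma cinner_scale_right: "cinner x (c *s y) = c * cinner x y"
  by (simp add: cinner_def sum_distrib_left mult_ac)

lemma cinner_scaleR_left: "cinner (r *\<^sub>R x) y = complex_of_real r * cinner x y"
  unfolding cinner_def vector_scaleR_component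
  by (simp add: sum_distrib_left scaleR_conv_of_real mult_ac)

lemma cinner_scaleR_right: "cinner x (r *\<^sub>R y) = complex_of_real r * cinner x y"
  unfolding cinner_def vector_scaleR_component
  by (simp add: sum_distrib_left scaleR_conv_of_real mult_ac)

lemma cinner_commute: "cinner y x = cnj (cinner x y)"
  by (simp add: cinner_def mult_ac)

lemma cinner_dagger: "cinner (A *v x) y = cinner x (dagger A *v y)"
proof -
  have "cinner (A *v x) y = (\<Sum>i\<in>UNIV. \<Sum>j\<in>UNIV. cnj (A $ i $ j) * cnj (x $ j) * y $ i)"
    by (simp add: cinner_def matrix_vector_mult_def sum_distrib_right)
  also have "\<dots> = (\<Sum>j\<in>UNIV. \<Sum>i\<in>UNIV. cnj (A $ i $ j) * cnj (x $ j) * y $ i)"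
    by (rule sum.swap)
  also have "\<dots> = cinner x (dagger A *v y)"
    by (simp add: cinner_def matrix_vector_mult_def dagger_def sum_distrib_left mult_ac)
  finally show ?thesis .
qed

lemma Re_cinner: "Re (cinner x y) = x \<bullet> y"
  by (simp add: cinner_def inner_vec_def inner_complex_def)

lemma cinner_self: "cinner x x = complex_of_real ((norm x)\<^sup>2)"
proof (rule complex_eqI)
  show "Im (cinner x x) = Im (complex_of_real ((norm x)\<^sup>2))"
    using cinner_commute[of x x] by (simp add: complex_eq_iff)
qed (simp add: Re_cinner power2_norm_eq_inner)

text \<open>The real inner products of \<open>y\<close> with \<open>x\<close> and with
  \<open>\<i> *s x\<close> are the real and imaginary parts of \<open>cinner x y\<close>. Complex
  orthogonality thereby becomes a pair of real conditions, accessible to real dimension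
  counting.\<close>

lemma cinner_eq_0_iff: "cinner x y = 0 \<longleftrightarrow> x \<bullet> y = 0 \<and> (\<i> *s x) \<bullet> y = 0"
proof -
  have "cinner (\<i> *s x) y = - \<i> * cinner x y"
    by (simp add: cinner_def sum_distrib_left mult_ac)
  then have "(\<i> *s x) \<bullet> y = Im (cinner x y)"
    by (simp flip: Re_cinner)
  then show ?thesis
    by (auto simp: complex_eq_iff Re_cinner)
qed

lemma dagger_dagger [simp]: "dagger (dagger A) = A"
  by (simp add: dagger_def vec_eq_iff)

lemma dagger_mult: "dagger (A ** B) = dagger B ** dagger A"
  by (simp add: dagger_def vec_eq_iff matrix_matrix_mult_def mult_ac)

lemma dagger_diag_real [simp]: "dagger (diag_real d) = diag_real d"
  by (simp add: dagger_def diag_real_def vec_eq_iff)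

lemma diag_real_mult: "diag_real d ** diag_real e = diag_real (\<lambda>i. d i * e i)"
  unfolding vec_eq_iff diag_real_mult_left by (simp add: diag_real_def)

lemma matrix_vector_mult_scaleR_complex:
  fixes A :: "complex^'n^'m"
  shows "A *v (r *\<^sub>R x) = r *\<^sub>R (A *v x)"
  by (simp add: vec_eq_iff matrix_vector_mult_def scaleR_sum_right)

lemma trace_mult_dagger:
  "trace (A ** dagger A) = complex_of_real (\<Sum>i\<in>UNIV. \<Sum>j\<in>UNIV. (cmod (A $ i $ j))\<^sup>2)"
  by (simp add: trace_def matrix_matrix_mult_def dagger_def flip: complex_norm_square)

text \<open>The eigenvector maximises the Rayleigh quotient on the unit sphere of \<open>S\<close>.\<close>

lemma selfadjoint_eigenvector_in_subspace:
  fixes f :: "'a::euclidean_space \<Rightarrow> 'a"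
  assumes f: "linear f" and sa: "\<And>x y. f x \<bullet> y = x \<bullet> f y"
    and S: "subspace S" and inv: "\<And>x. x \<in> S \<Longrightarrow> f x \<in> S" and ne: "z \<in> S" "z \<noteq> 0"
  obtains x l where "x \<in> S" "norm x = 1" "f x = l *\<^sub>R x"
proof -
  interpret f: linear f by (rule f)
  have c: "compact (sphere 0 1 \<inter> S)"
    by (intro compact_Int_closed compact_sphere closed_subspace S)
  have "(1 / norm z) *\<^sub>R z \<in> sphere 0 1 \<inter> S"
    using ne S by (simp add: subspace_scale)
  then have n: "sphere 0 1 \<inter> S \<noteq> {}" by blast
  have "continuous_on (sphere 0 1 \<inter> S) (\<lambda>x. f x \<bullet> x)"
    using f by (intro continuous_on_inner continuous_on_id linear_continuous_on)
      (simp add: linear_conv_bounded_linear)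
  then obtain x where x: "x \<in> sphere 0 1 \<inter> S"
    and xmax: "\<And>y. y \<in> sphere 0 1 \<inter> S \<Longrightarrow> f y \<bullet> y \<le> f x \<bullet> x"
    using continuous_attains_sup[OF c n] by blast
  define l where "l = f x \<bullet> x"
  \<comment> \<open>Homogeneity of degree two carries the bound from the unit sphere to all of
    \<open>S\<close>.\<close>
  have max: "f y \<bullet> y \<le> l * (y \<bullet> y)" if "y \<in> S" for y
  proof (cases "y = 0")
    case False
    then have "(1 / norm y) *\<^sub>R y \<in> sphere 0 1 \<inter> S"
      using that S by (simp add: subspace_scale)
    from xmax[OF this] False show ?thesis
      by (simp add: l_def f.scale dot_square_norm power2_eq_square field_simps)
  qed (simp add: f.zero)
  \<comment> \<open>\<open>w\<close> is the component of \<open>f x\<close> orthogonal to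
    \<open>x\<close>; the eigenvector equation amounts to \<open>w = 0\<close>.\<close>
  define w where "w = f x - l *\<^sub>R x"
  have wS: "w \<in> S" using x inv S by (simp add: w_def subspace_diff subspace_scale)
  have xx: "x \<bullet> x = 1" using x by (simp add: dot_square_norm)
  have xw: "x \<bullet> w = 0" by (simp add: w_def inner_diff_right xx l_def inner_commute)
  have fxw: "f x \<bullet> w = w \<bullet> w"
  proof -
    have "f x = w + l *\<^sub>R x" by (simp add: w_def)
    then show ?thesis by (simp add: inner_add_left xw)
  qed
  define K where "K = l * (w \<bullet> w) - f w \<bullet> w"
  \<comment> \<open>Moving from the maximiser \<open>x\<close> in direction \<open>w\<close> changes
    the two sides of \<open>max\<close> by a linear term \<open>2 * t * (w \<bullet> w)\<close> and
    quadratic terms collected in \<open>K\<close>. A linear term dominated by a quadratic one for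
    every \<open>t\<close> must vanish.\<close>
  have q: "2 * t * (w \<bullet> w) \<le> t\<^sup>2 * K" for t
  proof -
    have "x + t *\<^sub>R w \<in> S" using x wS S by (simp add: subspace_add subspace_scale)
    from max[OF this] have "f (x + t *\<^sub>R w) \<bullet> (x + t *\<^sub>R w)
        \<le> l * ((x + t *\<^sub>R w) \<bullet> (x + t *\<^sub>R w))" .
    moreover have "f w \<bullet> x = w \<bullet> w" using fxw sa[of w x] by (simp add: inner_commute)
    ultimately show ?thesis
      by (simp add: f.add f.scale inner_add_left inner_add_right xw xx fxw inner_commute[of w x]
          l_def[symmetric] K_def power2_eq_square algebra_simps)
  qed
  have "w \<bullet> w = 0"
  proof (rule ccontr)
    assume "w \<bullet> w \<noteq> 0"
    then have pos: "w \<bullet> w > 0" by simp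
    \<comment> \<open>A step short enough that \<open>t * K\<close> is at most
      \<open>w \<bullet> w\<close>; the added 1 keeps the denominator positive.\<close>
    define t where "t = (w \<bullet> w) / (\<bar>K\<bar> + 1)"
    have t: "t > 0" using pos by (simp add: t_def)
    have "2 * (w \<bullet> w) \<le> t * K" using q[of t] t by (simp add: power2_eq_square)
    also have "\<dots> \<le> t * (\<bar>K\<bar> + 1)" using t by (intro mult_left_mono) auto
    also have "\<dots> = w \<bullet> w" by (simp add: t_def)
    finally show False using pos by simp
  qed
  then have "f x = l *\<^sub>R x" by (simp add: w_def)
  then show ?thesis using x that[of x l] by simp
qed

text \<open>Induction on \<open>k\<close>: the complex orthogonal complement of the eigenvectors
  found so far is \<open>A\<close>-invariant and nonzero, so it contains another one. It is handled
  as a real subspace, on which \<open>A\<close> is self-adjoint for the real inner product; this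
  also makes the eigenvalues real.\<close>

lemma hermitian_orthonormal_eigenvectors:
  fixes A :: "complex^'n^'n"
  assumes A: "hermitian A" and "k \<le> CARD('n)"
  shows "\<exists>B. finite B \<and> card B = k \<and> (\<forall>x\<in>B. norm x = 1 \<and> (\<exists>l::real. A *v x = l *\<^sub>R x)) \<and>
    (\<forall>x\<in>B. \<forall>y\<in>B. x \<noteq> y \<longrightarrow> cinner x y = 0)"
  using assms(2)
proof (induction k)
  case 0
  show ?case by (intro exI[of _ "{}"]) auto
next
  case (Suc k)
  then obtain B where B: "finite B" "card B = k" "\<And>x. x \<in> B \<Longrightarrow> norm x = 1"
    and ev: "\<And>x. x \<in> B \<Longrightarrow> \<exists>l::real. A *v x = l *\<^sub>R x"
    and orth: "\<And>x y. x \<in> B \<Longrightarrow> y \<in> B \<Longrightarrow> x \<noteq> y \<Longrightarrow> cinner x y = 0"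
    by auto
  have dA: "dagger A = A" using A by (simp add: hermitian_def)
  define S where "S = {y. \<forall>x\<in>B. cinner x y = 0}"
  have S: "subspace S"
    by (auto simp: subspace_def S_def cinner_add_right cinner_scaleR_right)
  have inv: "A *v y \<in> S" if "y \<in> S" for y
  proof -
    have "cinner x (A *v y) = 0" if x: "x \<in> B" for x
    proof -
      obtain l :: real where "A *v x = l *\<^sub>R x" using ev x by blast
      then have "cinner x (A *v y) = complex_of_real l * cinner x y"
        using cinner_dagger[of A x y] by (simp add: dA cinner_scaleR_left)
      then show ?thesis using \<open>y \<in> S\<close> x by (simp add: S_def)
    qed
    then show ?thesis by (simp add: S_def)
  qed
  \<comment> \<open>The space has real dimension twice \<open>CARD('n)\<close>, while
    \<open>B\<close> and its multiples by \<open>\<i>\<close> span real dimension at most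
    \<open>2 * k\<close>. A vector orthogonal to both families in the real sense is orthogonal to
    \<open>B\<close> in the complex sense.\<close>
  have "dim (B \<union> (*s) \<i> ` B) \<le> card (B \<union> (*s) \<i> ` B)"
    using B by (intro dim_le_card') auto
  also have "\<dots> \<le> card B + card ((*s) \<i> ` B)" by (rule card_Un_le)
  also have "\<dots> \<le> k + k" using B card_image_le[of B "(*s) \<i>"] by simp
  also have "\<dots> < DIM(complex^'n)" using Suc.prems by simp
  finally obtain z where z: "z \<noteq> 0" "\<And>y. y \<in> span (B \<union> (*s) \<i> ` B) \<Longrightarrow> orthogonal z y"
    by (rule orthogonal_to_subspace_exists) blast
  have "z \<in> S"
    unfolding S_def using z(2)[OF span_base]
    by (auto simp: cinner_eq_0_iff orthogonal_def inner_commute[of _ z])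
  moreover have "linear ((*v) A)"
    by (rule linearI) (simp_all add: matrix_vector_right_distrib matrix_vector_mult_scaleR_complex)
  moreover have "(A *v x) \<bullet> y = x \<bullet> (A *v y)" for x y
    using cinner_dagger[of A x y] by (simp add: dA flip: Re_cinner)
  ultimately obtain x l where x: "x \<in> S" "norm x = 1" "A *v x = l *\<^sub>R x"
    using selfadjoint_eigenvector_in_subspace[of "(*v) A" S z] S inv z(1) by metis
  have "x \<notin> B"
    using x by (auto simp: S_def cinner_self)
  moreover have "cinner x y = 0" if "y \<in> B" for y
    using x(1) that cinner_commute[of x y] by (simp add: S_def)
  ultimately show ?case
    using B x ev orth by (intro exI[of _ "insert x B"]) (auto simp: S_def)
qed

lemma hermitian_spectral:
  fixes A :: "complex^'n^'n"
  assumes "hermitian A"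
  obtains U d where "unitary U" "A = U ** diag_real d ** dagger U"
proof -
  obtain B where B: "finite B" "card B = CARD('n)" "\<And>x. x \<in> B \<Longrightarrow> norm x = 1"
    and ev: "\<And>x. x \<in> B \<Longrightarrow> \<exists>l::real. A *v x = l *\<^sub>R x"
    and orth: "\<And>x y. x \<in> B \<Longrightarrow> y \<in> B \<Longrightarrow> x \<noteq> y \<Longrightarrow> cinner x y = 0"
    using hermitian_orthonormal_eigenvectors[OF assms order_refl] by auto
  obtain h where h: "bij_betw h (UNIV :: 'n set) B"
    using B by (metis finite_same_card_bij finite)
  have hB: "h i \<in> B" for i using h by (auto simp: bij_betw_def)
  have "\<forall>i. \<exists>l::real. A *v h i = l *\<^sub>R h i" using ev hB by blast
  then obtain d :: "'n \<Rightarrow> real" where d: "\<And>i. A *v h i = d i *\<^sub>R h i"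
    using choice[of "\<lambda>i l. A *v h i = l *\<^sub>R h i"] by blast
  define U :: "complex^'n^'n" where "U = (\<chi> i j. h j $ i)"
  have "h i = h j \<longleftrightarrow> i = j" for i j
    using h by (auto simp: bij_betw_def inj_on_def)
  then have "cinner (h i) (h j) = (if i = j then 1 else 0)" for i j
    using orth[OF hB hB] B(3)[OF hB] by (simp add: cinner_self)
  then have U1: "dagger U ** U = mat 1"
    by (simp add: vec_eq_iff matrix_matrix_mult_def dagger_def U_def mat_def cinner_def)
  then have U2: "U ** dagger U = mat 1"
    by (simp add: matrix_left_right_inverse)
  have "(A ** U) $ i $ j = (A *v h j) $ i" for i j
    by (simp add: matrix_matrix_mult_def matrix_vector_mult_def U_def)
  then have "(A ** U) $ i $ j = h j $ i * complex_of_real (d j)" for i j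
    unfolding d vector_scaleR_component by (simp add: scaleR_conv_of_real mult.commute)
  then have "A ** U = U ** diag_real d"
    by (simp add: vec_eq_iff diag_real_mult_right U_def)
  then have "A = U ** diag_real d ** dagger U"
    by (metis U2 matrix_mul_assoc matrix_mul_rid)
  then show ?thesis using that U1 U2 by (auto simp: unitary_def)
qed

text \<open>Each \<open>d i\<close> is the value of the quadratic form of \<open>A\<close> at the
  \<open>i\<close>-th column of \<open>U\<close>.\<close>

lemma pos_semidef_spectral:
  fixes A :: "complex^'n^'n"
  assumes "pos_semidef A"
  obtains U d where "unitary U" "A = U ** diag_real d ** dagger U" "\<And>i. 0 \<le> d i"
proof -
  obtain U d where U: "unitary U" and A: "A = U ** diag_real d ** dagger U"
    using assms hermitian_spectral by (auto simp: pos_semidef_def)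
  have U1: "dagger U ** U = mat 1" using U by (simp add: unitary_def)
  have "0 \<le> d i" for i
  proof -
    have "A *v (U *v axis i 1) = (U ** diag_real d ** (dagger U ** U)) *v axis i 1"
      by (simp add: A matrix_vector_mul_assoc matrix_mul_assoc)
    also have "\<dots> = U *v (diag_real d *v axis i 1)"
      by (simp add: U1 matrix_vector_mul_assoc)
    finally have "cinner (U *v axis i 1) (A *v (U *v axis i 1))
        = cinner (axis i 1) (dagger U *v (U *v (diag_real d *v axis i 1)))"
      by (simp add: cinner_dagger)
    also have "\<dots> = cinner (axis i 1) (diag_real d *v axis i 1)"
      by (metis U1 matrix_vector_mul_assoc matrix_vector_mul_lid)
    also have "\<dots> = d i"
      by (simp add: cinner_def axis_def matrix_vector_mult_def diag_real_def
          if_distrib[of "\<lambda>x. _ * x"] if_distrib[of "\<lambda>x. x * _"] if_distrib[of cnj] cong: if_cong)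
    finally show ?thesis using assms
      by (metis Re_complex_of_real pos_semidef_def)
  qed
  with U A that show ?thesis by blast
qed

text \<open>The square root of the spectrum supplies \<open>C\<close>. In Gram form, positivity
  passes easily to tensor products, and traces against projectors become sums of squares.\<close>

lemma pos_semidef_iff_gram:
  fixes A :: "complex^'n^'n"
  shows "pos_semidef A \<longleftrightarrow> (\<exists>C :: complex^'n^'n. A = C ** dagger C)"
proof
  assume "pos_semidef A"
  then obtain U d where U: "unitary U" "A = U ** diag_real d ** dagger U" "\<And>i. 0 \<le> d i"
    using pos_semidef_spectral by blast
  define R where "R = diag_real (\<lambda>i. sqrt (d i))"
  have "diag_real d = R ** R" using U(3) by (simp add: R_def diag_real_mult)
  then have "A = (U ** R) ** dagger (U ** R)"
    by (simp add: U(2) dagger_mult R_def matrix_mul_assoc)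
  then show "\<exists>C :: complex^'n^'n. A = C ** dagger C" by blast
next
  assume "\<exists>C :: complex^'n^'n. A = C ** dagger C"
  then obtain C :: "complex^'n^'n" where A: "A = C ** dagger C" by blast
  have "cinner x (A *v x) = cinner (dagger C *v x) (dagger C *v x)" for x
    by (simp add: cinner_dagger A matrix_vector_mul_assoc)
  then show "pos_semidef A"
    by (simp add: pos_semidef_def hermitian_def A dagger_mult cinner_self)
qed

section \<open>Entropies of a density matrix\<close>

lemma density_matrix_spectral:
  fixes \<rho> :: "complex^'n^'n"
  assumes "density_matrix \<rho>"
  obtains U d where "unitary U" "\<rho> = U ** diag_real d ** dagger U" "\<And>i. 0 \<le> d i"
    "(\<Sum>i\<in>UNIV. d i) = 1"
proof -
  obtain U d where U: "unitary U" and \<rho>: "\<rho> = U ** diag_real d ** dagger U"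
    and d: "\<And>i. 0 \<le> d i"
    using assms pos_semidef_spectral unfolding density_matrix_def by blast
  have "trace \<rho> = trace (dagger U ** (U ** diag_real d))"
    unfolding \<rho> by (rule trace_mul_sym)
  also have "\<dots> = trace (diag_real d)"
    using U by (simp add: matrix_mul_assoc unitary_def)
  also have "\<dots> = complex_of_real (\<Sum>i\<in>UNIV. d i)"
    by (simp add: trace_def diag_real_def)
  finally have "(\<Sum>i\<in>UNIV. d i) = 1"
    using assms by (simp add: density_matrix_def flip: of_real_sum)
  with U \<rho> d that show ?thesis by blast
qed

text \<open>Serves to treat the eigenprojectors of a state as states themselves, so that facts about
  outcome probabilities apply to them.\<close>

lemma density_matrix_unitary_conj:
  assumes U: "unitary U" and d: "\<And>i. 0 \<le> d i" "(\<Sum>i\<in>UNIV. d i) = 1"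
  shows "density_matrix (U ** diag_real d ** dagger U)"
proof -
  define R where "R = diag_real (\<lambda>i. sqrt (d i))"
  have "diag_real d = R ** R" using d by (simp add: R_def diag_real_mult)
  then have "U ** diag_real d ** dagger U = (U ** R) ** dagger (U ** R)"
    by (simp add: dagger_mult R_def matrix_mul_assoc)
  then have "pos_semidef (U ** diag_real d ** dagger U)"
    unfolding pos_semidef_iff_gram by blast
  moreover have "trace (U ** diag_real d ** dagger U) = trace (dagger U ** (U ** diag_real d))"
    by (rule trace_mul_sym)
  moreover have "\<dots> = complex_of_real (\<Sum>i\<in>UNIV. d i)"
    using U by (simp add: matrix_mul_assoc unitary_def trace_def diag_real_def)
  ultimately show ?thesis using d by (simp add: density_matrix_def)
qed

lemma von_neumann_entropy_spectral:
  assumes U: "unitary U" and \<rho>: "\<rho> = U ** diag_real d ** dagger U"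
  shows "von_neumann_entropy \<rho> = - (\<Sum>i\<in>UNIV. d i * log 2 (d i))"
proof -
  have U1: "dagger U ** U = mat 1" using U by (simp add: unitary_def)
  have "\<rho> ** matrix_fun (log 2) \<rho>
      = U ** diag_real d ** (dagger U ** U) ** diag_real (\<lambda>i. log 2 (d i)) ** dagger U"
    unfolding matrix_fun_eq[OF U \<rho>] by (simp add: \<rho> matrix_mul_assoc)
  also have "\<dots> = U ** (diag_real d ** diag_real (\<lambda>i. log 2 (d i))) ** dagger U"
    by (simp add: U1 matrix_mul_assoc)
  finally have "trace (\<rho> ** matrix_fun (log 2) \<rho>)
      = trace (dagger U ** (U ** diag_real (\<lambda>i. d i * log 2 (d i))))"
    by (simp add: diag_real_mult trace_mul_sym[of _ "dagger U"])
  also have "\<dots> = complex_of_real (\<Sum>i\<in>UNIV. d i * log 2 (d i))"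
    by (simp add: matrix_mul_assoc U1 trace_def diag_real_def)
  finally show ?thesis by (simp add: von_neumann_entropy_def)
qed

text \<open>Jensen's inequality for x log x on the closed half-line, by comparison with the tangent
  at the mean \<open>p\<close>. It serves both for the comparison of entropies and, with weights
  1/2, for the bound on binary entropy.\<close>

lemma mult_log_convex_sum:
  fixes q d :: "'a \<Rightarrow> real"
  assumes I: "finite I" and q: "\<And>i. i \<in> I \<Longrightarrow> 0 \<le> q i" "sum q I = 1"
    and d: "\<And>i. i \<in> I \<Longrightarrow> 0 \<le> d i"
  shows "(\<Sum>i\<in>I. q i * d i) * log 2 (\<Sum>i\<in>I. q i * d i) \<le> (\<Sum>i\<in>I. q i * (d i * log 2 (d i)))"
proof -
  define p where "p = (\<Sum>i\<in>I. q i * d i)"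
  have "p * ln p \<le> (\<Sum>i\<in>I. q i * (d i * ln (d i)))"
  proof (cases "p = 0")
    case True
    then have "q i * d i = 0" if "i \<in> I" for i
      using that I q d by (simp add: p_def sum_nonneg_eq_0_iff)
    then have "(\<Sum>i\<in>I. q i * (d i * ln (d i))) = 0"
      by (intro sum.neutral) auto
    then show ?thesis using True by simp
  next
    case False
    moreover have "p \<ge> 0" using q d by (auto simp: p_def intro: sum_nonneg)
    ultimately have p: "p > 0" by simp
    \<comment> \<open>The left side is the tangent of x ln x at \<open>p\<close>, evaluated at
      \<open>d i\<close>. For positive \<open>d i\<close> the bound is ln u <= u - 1 at u =
      \<open>p / d i\<close>; at 0 it reads -p <= 0.\<close>
    have tangent: "d i * ln p + d i - p \<le> d i * ln (d i)" if "i \<in> I" for i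
    proof (cases "d i = 0")
      case False
      then have di: "d i > 0" using d[OF that] by simp
      have "ln (p / d i) \<le> p / d i - 1" using p di by (intro ln_le_minus_one) simp
      then have "d i * (ln p - ln (d i)) \<le> d i * (p / d i - 1)"
        using p di by (intro mult_left_mono) (simp_all add: ln_div)
      then show ?thesis using di by (simp add: algebra_simps)
    qed (use p in simp)
    \<comment> \<open>The tangent is affine and the weights sum to 1, so its average is its value at
      the mean.\<close>
    have "p * ln p = (\<Sum>i\<in>I. q i * (d i * ln p + d i - p))"
    proof -
      have "(\<Sum>i\<in>I. q i * (d i * ln p + d i - p))
          = (\<Sum>i\<in>I. q i * d i) * ln p + (\<Sum>i\<in>I. q i * d i) - sum q I * p"
        by (simp add: algebra_simps sum.distrib sum_subtractf sum_distrib_left)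
      then show ?thesis by (simp add: q flip: p_def)
    qed
    also have "\<dots> \<le> (\<Sum>i\<in>I. q i * (d i * ln (d i)))"
      by (intro sum_mono mult_left_mono tangent q)
    finally show ?thesis .
  qed
  then have "p * ln p / ln 2 \<le> (\<Sum>i\<in>I. q i * (d i * ln (d i))) / ln 2"
    by (intro divide_right_mono) auto
  then show ?thesis
    by (simp add: p_def log_def sum_divide_distrib)
qed

section \<open>Outcome distributions of measurements\<close>

lemma outcome_prob_sum:
  assumes "finite F"
  shows "outcome_prob \<rho> (\<Sum>P\<in>F. P) = (\<Sum>P\<in>F. outcome_prob \<rho> P)"
  using assms
proof induction
  case empty
  show ?case by (simp add: outcome_prob_def trace_def matrix_matrix_mult_def)
next
  case (insert P F)
  then show ?case
    by (simp add: outcome_prob_def matrix_add_ldistrib trace_add)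
qed

text \<open>With \<rho> = C C^*, idempotence and cyclicity of the trace turn the probability into
  the squared Frobenius norm of \<open>P ** C\<close>.\<close>

lemma outcome_prob_nonneg:
  fixes \<rho> :: "complex^'n^'n"
  assumes "pos_semidef \<rho>" and P: "hermitian P" "P ** P = P"
  shows "0 \<le> outcome_prob \<rho> P"
proof -
  obtain C :: "complex^'n^'n" where \<rho>: "\<rho> = C ** dagger C"
    using assms pos_semidef_iff_gram by blast
  have "trace (\<rho> ** P) = trace (\<rho> ** P ** P)"
    using P by (simp flip: matrix_mul_assoc)
  also have "\<dots> = trace (P ** (\<rho> ** P))" by (rule trace_mul_sym)
  also have "P ** (\<rho> ** P) = (P ** C) ** dagger (P ** C)"
    using P by (simp add: \<rho> dagger_mult hermitian_def matrix_mul_assoc)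
  finally show ?thesis
    by (simp add: outcome_prob_def trace_mult_dagger sum_nonneg)
qed

lemma measurement_outcome_prob:
  assumes "density_matrix \<rho>" and "von_neumann_measurement \<P>"
  shows "P \<in> \<P> \<Longrightarrow> 0 \<le> outcome_prob \<rho> P" and "(\<Sum>P\<in>\<P>. outcome_prob \<rho> P) = 1"
proof -
  show "P \<in> \<P> \<Longrightarrow> 0 \<le> outcome_prob \<rho> P"
    using assms
    by (intro outcome_prob_nonneg)
      (auto simp: density_matrix_def von_neumann_measurement_def rank_one_projector_def)
  have "(\<Sum>P\<in>\<P>. outcome_prob \<rho> P) = outcome_prob \<rho> (\<Sum>P\<in>\<P>. P)"
    using assms by (intro outcome_prob_sum[symmetric]) (simp add: von_neumann_measurement_def)
  also have "\<dots> = 1"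
    using assms by (simp add: outcome_prob_def von_neumann_measurement_def density_matrix_def)
  finally show "(\<Sum>P\<in>\<P>. outcome_prob \<rho> P) = 1" .
qed

text \<open>Rank one gives entries of the form \<open>c i * w $ j\<close>, whence
  \<open>P ** P\<close> is \<open>trace P\<close> times \<open>P\<close>. Idempotence and a nonzero
  entry then fix the trace.\<close>

lemma rank_one_projector_trace:
  fixes P :: "complex^'n^'n"
  assumes "rank_one_projector P"
  shows "trace P = 1"
proof -
  have PP: "P ** P = P" and "vec.dim (rows P) = 1"
    using assms by (auto simp: rank_one_projector_def row_rank_def_gen)
  with vec.basis_exists[of "rows P"] obtain B where
    B: "B \<subseteq> rows P" "vec.independent B" "rows P \<subseteq> vec.span B" "card B = 1"
    by metis
  then obtain w where w: "B = {w}" by (auto simp: card_1_singleton_iff)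
  have "w \<noteq> 0" using B w by (metis vec.dependent_zero singletonI)
  have "row i P \<in> range (\<lambda>c. c *s w)" for i
    using B w by (auto simp: rows_def vec.span_singleton)
  then have "\<forall>i. \<exists>c. row i P = c *s w" by blast
  then obtain c where c: "\<And>i. row i P = c i *s w"
    using choice[of "\<lambda>i c. row i P = c *s w"] by blast
  have Pc: "P $ i $ j = c i * w $ j" for i j
    using arg_cong[OF c[of i], of "\<lambda>v. v $ j"] by (simp add: row_def)
  obtain j where j: "w $ j \<noteq> 0" using \<open>w \<noteq> 0\<close> by (auto simp: vec_eq_iff)
  obtain i where i: "row i P = w" using B w by (auto simp: rows_def)
  then have ci: "c i \<noteq> 0" using c[of i] \<open>w \<noteq> 0\<close> by auto
  have "P $ i $ j = (\<Sum>k\<in>UNIV. P $ i $ k * P $ k $ j)"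
    using arg_cong[OF PP, of "\<lambda>M. M $ i $ j"] by (simp add: matrix_matrix_mult_def)
  also have "\<dots> = P $ i $ j * trace P"
    by (simp add: Pc trace_def sum_distrib_left mult_ac)
  finally show ?thesis using ci j by (simp add: Pc)
qed

text \<open>Taking traces in the resolution of the identity counts the projectors.\<close>

lemma measurement_card:
  fixes \<P> :: "(complex^'n^'n) set"
  assumes "von_neumann_measurement \<P>"
  shows "card \<P> = CARD('n)"
proof -
  have tr: "trace (\<Sum>P\<in>F. P) = (\<Sum>P\<in>F. trace P)" if "finite F" for F :: "(complex^'n^'n) set"
    using that by induction (simp_all add: trace_add trace_def sum.distrib)
  have "of_nat (card \<P>) = (\<Sum>P\<in>\<P>. trace P)"
    using assms by (simp add: von_neumann_measurement_def rank_one_projector_trace)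
  also have "\<dots> = trace (\<Sum>P\<in>\<P>. P)"
    using assms by (intro tr[symmetric]) (simp add: von_neumann_measurement_def)
  also have "\<dots> = (of_nat CARD('n) :: complex)"
    using assms by (simp add: von_neumann_measurement_def trace_I)
  finally show ?thesis by (simp only: of_nat_eq_iff)
qed

lemma outcome_prob_unitary_conj:
  "outcome_prob (U ** diag_real d ** dagger U) P
    = (\<Sum>i\<in>UNIV. d i * Re ((dagger U ** P ** U) $ i $ i))"
proof -
  have "trace (U ** diag_real d ** dagger U ** P) = trace (U ** (diag_real d ** (dagger U ** P)))"
    by (simp add: matrix_mul_assoc)
  also have "\<dots> = trace (diag_real d ** (dagger U ** P) ** U)" by (rule trace_mul_sym)
  also have "\<dots> = trace (diag_real d ** (dagger U ** P ** U))"
    by (simp add: matrix_mul_assoc)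
  finally show ?thesis
    by (simp add: outcome_prob_def trace_def diag_real_mult_left)
qed

text \<open>The overlaps \<open>q P i\<close> of the projectors with the eigenvectors of \<open>\<rho>\<close> form a doubly
  stochastic matrix, which maps the spectrum of \<open>\<rho>\<close> to the outcome distribution.\<close>

lemma von_neumann_entropy_le_klein_entropy:
  fixes \<rho> :: "complex^'n^'n"
  assumes \<rho>: "density_matrix \<rho>" and \<P>: "von_neumann_measurement \<P>"
  shows "von_neumann_entropy \<rho> \<le> klein_entropy \<rho> \<P>"
proof -
  obtain U d where U: "unitary U" and \<rho>U: "\<rho> = U ** diag_real d ** dagger U"
    and d: "\<And>i. 0 \<le> d i" "(\<Sum>i\<in>UNIV. d i) = 1"
    using density_matrix_spectral[OF \<rho>] by blast
  define q where "q P i = Re ((dagger U ** P ** U) $ i $ i)" for P i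
  \<comment> \<open>\<open>e i\<close> is the projector onto the \<open>i\<close>-th eigenvector,
    and \<open>q P i\<close> is the probability of outcome \<open>P\<close> in this state.
    Nonnegativity and unit column sums are thus properties of an outcome distribution.\<close>
  define e where "e i = U ** diag_real (\<lambda>j. of_bool (j = i)) ** dagger U" for i
  have e: "density_matrix (e i)" for i
    unfolding e_def by (intro density_matrix_unitary_conj U) auto
  have q: "q P i = outcome_prob (e i) P" for P i
    by (simp add: q_def e_def outcome_prob_unitary_conj)
  have q0: "0 \<le> q P i" if "P \<in> \<P>" for P i
    unfolding q using measurement_outcome_prob(1)[OF e \<P> that] .
  have qcol: "(\<Sum>P\<in>\<P>. q P i) = 1" for i
    unfolding q using measurement_outcome_prob(2)[OF e \<P>] .
  \<comment> \<open>The row sum is the trace of a unitary conjugate of \<open>P\<close>, which is 1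
    by rank one.\<close>
  have qrow: "(\<Sum>i\<in>UNIV. q P i) = 1" if "P \<in> \<P>" for P
  proof -
    have "trace (dagger U ** P ** U) = trace (U ** (dagger U ** P))" by (rule trace_mul_sym)
    also have "\<dots> = trace P" using U by (simp add: matrix_mul_assoc unitary_def)
    also have "\<dots> = 1"
      using that \<P> by (simp add: rank_one_projector_trace von_neumann_measurement_def)
    finally have "Re (trace (dagger U ** P ** U)) = 1" by simp
    then show ?thesis by (simp add: q_def trace_def)
  qed
  have p: "outcome_prob \<rho> P = (\<Sum>i\<in>UNIV. q P i * d i)" for P
    by (simp add: \<rho>U outcome_prob_unitary_conj q_def mult.commute)
  \<comment> \<open>Jensen is applied in each row; after exchanging the sums, the column sums remove
    the weights.\<close>
  have "(\<Sum>P\<in>\<P>. outcome_prob \<rho> P * log 2 (outcome_prob \<rho> P))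
      \<le> (\<Sum>P\<in>\<P>. \<Sum>i\<in>UNIV. q P i * (d i * log 2 (d i)))"
    unfolding p by (intro sum_mono mult_log_convex_sum q0 qrow d) auto
  also have "\<dots> = (\<Sum>i\<in>UNIV. \<Sum>P\<in>\<P>. q P i * (d i * log 2 (d i)))"
    by (rule sum.swap)
  also have "\<dots> = (\<Sum>i\<in>UNIV. d i * log 2 (d i))"
    by (simp add: qcol flip: sum_distrib_right)
  finally show ?thesis
    by (simp add: klein_entropy_def von_neumann_entropy_spectral[OF U \<rho>U])
qed

text \<open>Supplies the lower bound that makes the real infimum over product states meaningful.
  Every probability is at most the total 1, so its logarithm is nonpositive unless the probability
  vanishes.\<close>

lemma klein_entropy_nonneg:
  assumes "density_matrix \<rho>" and \<P>: "von_neumann_measurement \<P>"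
  shows "0 \<le> klein_entropy \<rho> \<P>"
proof -
  have fin: "finite \<P>" using \<P> by (simp add: von_neumann_measurement_def)
  have "outcome_prob \<rho> P * log 2 (outcome_prob \<rho> P) \<le> 0" if "P \<in> \<P>" for P
  proof (cases "outcome_prob \<rho> P = 0")
    case False
    moreover have "outcome_prob \<rho> P \<le> (\<Sum>P\<in>\<P>. outcome_prob \<rho> P)"
      using measurement_outcome_prob(1)[OF assms] that fin by (intro member_le_sum) auto
    ultimately show ?thesis
      using measurement_outcome_prob[OF assms] that
      by (intro mult_nonneg_nonpos) (auto simp: less_le)
  qed simp
  then show ?thesis by (simp add: klein_entropy_def sum_nonpos)
qed

section \<open>Product states\<close>

lemma sum_UNIV_prod:
  fixes f :: "'a::finite \<times> 'b::finite \<Rightarrow> 'c::comm_monoid_add"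
  shows "(\<Sum>x\<in>UNIV. f x) = (\<Sum>a\<in>UNIV. \<Sum>b\<in>UNIV. f (a, b))"
  by (simp add: sum.cartesian_product)

lemma mat_tensor_mult: "mat_tensor A B ** mat_tensor C D = mat_tensor (A ** C) (B ** D)"
  by (simp add: vec_eq_iff mat_tensor_def matrix_matrix_mult_def sum_product sum_UNIV_prod mult_ac)

lemma dagger_mat_tensor: "dagger (mat_tensor A B) = mat_tensor (dagger A) (dagger B)"
  by (simp add: vec_eq_iff mat_tensor_def dagger_def)

lemma trace_mat_tensor: "trace (mat_tensor A B) = trace A * trace B"
  by (simp add: mat_tensor_def trace_def sum_product sum_UNIV_prod)

lemma density_matrix_mat_tensor:
  fixes A :: "complex^'a::finite^'a" and B :: "complex^'b::finite^'b"
  assumes "density_matrix A" "density_matrix B"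
  shows "density_matrix (mat_tensor A B)"
proof -
  obtain C :: "complex^'a^'a" and D :: "complex^'b^'b"
    where "A = C ** dagger C" "B = D ** dagger D"
    using assms by (auto simp: density_matrix_def pos_semidef_iff_gram)
  then have "mat_tensor A B = mat_tensor C D ** dagger (mat_tensor C D)"
    by (simp add: dagger_mat_tensor mat_tensor_mult)
  then have "pos_semidef (mat_tensor A B)"
    unfolding pos_semidef_iff_gram by blast
  then show ?thesis
    using assms by (simp add: density_matrix_def trace_mat_tensor)
qed

text \<open>Ensures that the real supremum is taken over a nonempty family. The witness is the
  measurement in the standard basis.\<close>

lemma von_neumann_measurement_exists: "\<exists>\<P> :: (complex^'n^'n) set. von_neumann_measurement \<P>"
proof -
  define E :: "'n \<Rightarrow> complex^'n^'n" where "E k = diag_real (\<lambda>i. of_bool (i = k))" for k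
  have mult: "E k ** E l = (if k = l then E k else 0)" for k l
    by (auto simp: E_def diag_real_mult) (auto simp: vec_eq_iff diag_real_def)
  have "rank (E k) = 1" for k
  proof -
    have row: "row i (E k) = (if i = k then axis k 1 else 0)" for i
      by (auto simp: row_def E_def diag_real_def axis_def vec_eq_iff)
    have "rows (E k) \<subseteq> {0, axis k 1}" "axis k 1 \<in> rows (E k)"
      by (auto simp: rows_def row intro!: exI[of _ k])
    then show ?thesis
      unfolding row_rank_def_gen
      by (intro vec.dim_unique[of "{axis k 1}"])
        (auto simp: vec.span_zero vec.span_base vec.dependent_single axis_eq_0_iff)
  qed
  then have r1: "rank_one_projector (E k)" for k
    by (simp add: rank_one_projector_def mult) (simp add: hermitian_def E_def)
  \<comment> \<open>A measurement is a set, so distinct indices must give distinct projectors for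
    its sum to be the sum over indices.\<close>
  have inj: "inj E"
  proof (rule injI)
    fix k l assume "E k = E l"
    then have "E k $ k $ k = E l $ k $ k" by simp
    then show "k = l" by (simp add: E_def diag_real_def split: if_splits)
  qed
  have "(\<Sum>P\<in>range E. P) = (\<Sum>k\<in>UNIV. E k)"
    by (simp add: sum.reindex[OF inj])
  also have "\<dots> = mat 1"
    by (auto simp: vec_eq_iff E_def diag_real_def mat_def of_bool_def if_distrib[of complex_of_real]
        cong: if_cong)
  finally have "von_neumann_measurement (range E)"
    by (auto simp: von_neumann_measurement_def r1 mult)
  then show ?thesis ..
qed


section \<open>Pure states and product vectors\<close>

definition outer :: "complex^'n \<Rightarrow> complex^'n^'n" where
  "outer v = (\<chi> i j. v $ i * cnj (v $ j))"

lemma outer_mult_vec: "outer v *v x = cinner v x *s v"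
  by (simp add: vec_eq_iff outer_def matrix_vector_mult_def cinner_def sum_distrib_left mult_ac)

lemma density_matrix_outer:
  assumes "norm v = 1"
  shows "density_matrix (outer v)"
proof -
  have "hermitian (outer v)"
    by (simp add: hermitian_def outer_def dagger_def vec_eq_iff mult.commute)
  moreover have "0 \<le> Re (cinner x (outer v *v x))" for x
    by (simp add: outer_mult_vec cinner_scale_right cinner_commute[of v x])
  moreover have "trace (outer v) = cinner v v"
    by (simp add: trace_def outer_def cinner_def mult.commute)
  ultimately show ?thesis
    using assms by (simp add: density_matrix_def pos_semidef_def cinner_self)
qed

lemma outcome_prob_outer: "outcome_prob (outer v) P = Re (cinner v (P *v v))"
proof -
  have "trace (outer v ** P) = trace (P ** outer v)" by (rule trace_mul_sym)
  also have "\<dots> = cinner v (P *v v)"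
    by (simp add: trace_def outer_def matrix_matrix_mult_def matrix_vector_mult_def cinner_def
        sum_distrib_left mult_ac)
  finally show ?thesis by (simp add: outcome_prob_def)
qed

lemma mat_tensor_outer:
  "mat_tensor (outer a) (outer b) = outer (\<chi> i. a $ fst i * b $ snd i)"
  by (simp add: vec_eq_iff mat_tensor_def outer_def mult_ac)

text \<open>A vector is a product vector iff its coefficient matrix has vanishing determinant; on the
  line \<open>v + t w\<close> this is a polynomial equation in \<open>t\<close> of degree at most two.\<close>

lemma product_vector_in_plane:
  fixes v w :: "complex^(2 \<times> 2)"
  obtains \<alpha> \<beta> where "(\<alpha>, \<beta>) \<noteq> (0, 0)"
    "\<And>i j p q. (\<alpha> *s v + \<beta> *s w) $ (i, j) * (\<alpha> *s v + \<beta> *s w) $ (p, q)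
      = (\<alpha> *s v + \<beta> *s w) $ (i, q) * (\<alpha> *s v + \<beta> *s w) $ (p, j)"
proof -
  \<comment> \<open>\<open>D\<close> is the determinant of the 2 x 2 coefficient matrix; when it
    vanishes, so do all minors, including the degenerate ones with repeated indices.\<close>
  define D where "D x = x $ (1, 1) * x $ (2, 2) - x $ (1, 2) * x $ (2, 1)" for x :: "complex^(2 \<times> 2)"
  have D: "x $ (i, j) * x $ (p, q) = x $ (i, q) * x $ (p, j)" if "D x = 0" for x i j p q
    using that exhaust_2[of i] exhaust_2[of j] exhaust_2[of p] exhaust_2[of q]
    by (auto simp: D_def mult_ac)
  have "\<exists>\<alpha> \<beta>. (\<alpha>, \<beta>) \<noteq> (0, 0) \<and> D (\<alpha> *s v + \<beta> *s w) = 0"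
  proof (cases "D w = 0")
    case True
    then show ?thesis by (intro exI[of _ 0] exI[of _ 1]) simp
  next
    case False
    \<comment> \<open>\<open>m\<close> is the coefficient of \<open>t\<close> in
      \<open>D (v + t w)\<close>. As \<open>D w\<close> is nonzero, the quadratic formula yields a
      complex root \<open>t\<close>.\<close>
    define m where "m = v $ (1, 1) * w $ (2, 2) + w $ (1, 1) * v $ (2, 2)
      - v $ (1, 2) * w $ (2, 1) - w $ (1, 2) * v $ (2, 1)"
    define r where "r = csqrt (m\<^sup>2 - 4 * D w * D v)"
    define t where "t = (r - m) / (2 * D w)"
    have "D (1 *s v + t *s w) = D v + t * m + t\<^sup>2 * D w"
      by (simp add: D_def m_def algebra_simps power2_eq_square)
    \<comment> \<open>Multiplication by \<open>4 * D w\<close> completes the square.\<close>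
    also have "4 * D w * \<dots> = (2 * D w * t + m)\<^sup>2 - (m\<^sup>2 - 4 * D w * D v)"
      by (simp add: algebra_simps power2_eq_square)
    also have "2 * D w * t + m = r" using False by (simp add: t_def)
    also have "r\<^sup>2 - (m\<^sup>2 - 4 * D w * D v) = 0" by (simp add: r_def)
    finally have "D (1 *s v + t *s w) = 0" using False by simp
    then show ?thesis by (intro exI[of _ 1] exI[of _ t]) simp
  qed
  with D that show ?thesis by blast
qed

text \<open>Vanishing minors mean a coefficient matrix of rank one: it is the column through a
  nonzero entry times the row through it, divided by that entry. Normalising both factors rescales
  \<open>x\<close> by a real number.\<close>

lemma product_vector_factor:
  fixes x :: "complex^('a::finite \<times> 'b::finite)"
  assumes "x \<noteq> 0" and minors: "\<And>i j p q. x $ (i, j) * x $ (p, q) = x $ (i, q) * x $ (p, j)"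
  obtains a :: "complex^'a" and b :: "complex^'b" and c :: real
  where "norm a = 1" "norm b = 1" "(\<chi> i. a $ fst i * b $ snd i) = c *\<^sub>R x"
proof -
  obtain k where "x $ k \<noteq> 0" using \<open>x \<noteq> 0\<close> by (auto simp: vec_eq_iff)
  then obtain p q where pq: "x $ (p, q) \<noteq> 0" by (cases k) auto
  define a where "a = (\<chi> i. x $ (i, q))"
  define b where "b = (\<chi> j. x $ (p, j) / x $ (p, q))"
  have "a $ p \<noteq> 0" "b $ q \<noteq> 0" using pq by (simp_all add: a_def b_def)
  then have ne: "norm a \<noteq> 0" "norm b \<noteq> 0" by auto
  have ab: "a $ i * b $ j = x $ (i, j)" for i j
    using minors[of i j p q] pq by (simp add: a_def b_def field_simps)
  show ?thesis
  proof
    show "norm ((1 / norm a) *\<^sub>R a) = 1" "norm ((1 / norm b) *\<^sub>R b) = 1" using ne by simp_all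
    show "(\<chi> i. ((1 / norm a) *\<^sub>R a) $ fst i * ((1 / norm b) *\<^sub>R b) $ snd i)
        = (1 / (norm a * norm b)) *\<^sub>R x"
      unfolding vec_eq_iff vector_scaleR_component by (simp add: ab)
  qed
qed

text \<open>The product state lives in the span of the ranges of two of the four projectors, so it has
  only two possible outcomes.\<close>

lemma product_state_klein_entropy_le_1:
  fixes \<P> :: "(complex^(2 \<times> 2)^(2 \<times> 2)) set"
  assumes \<P>: "von_neumann_measurement \<P>"
  obtains \<delta> where "\<delta> \<in> product_states" "klein_entropy \<delta> \<P> \<le> 1"
proof -
  have fin: "finite \<P>" using \<P> by (simp add: von_neumann_measurement_def)
  have "card \<P> = 4" using measurement_card[OF \<P>] by simp
  then obtain T where "T \<subseteq> \<P>" "card T = 2"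
    using obtain_subset_with_card_n[of 2 \<P>] by auto
  then obtain P Q where P: "P \<in> \<P>" and Q: "Q \<in> \<P>" and "P \<noteq> Q"
    by (auto simp: card_2_iff)
  have other: "R ** P = 0" "R ** Q = 0" if "R \<in> \<P>" "R \<noteq> P" "R \<noteq> Q" for R
    using \<P> P Q \<open>P \<noteq> Q\<close> that by (auto simp: von_neumann_measurement_def)
  \<comment> \<open>\<open>R\<close> has trace 1 and is therefore nonzero; by idempotence it fixes
    every vector of its range.\<close>
  have eigenvector: "\<exists>v. v \<noteq> 0 \<and> R *v v = v" if "R \<in> \<P>" for R
  proof -
    have R: "rank_one_projector R" using that \<P> by (simp add: von_neumann_measurement_def)
    then have "R \<noteq> 0" using rank_one_projector_trace[OF R] by (auto simp: trace_def)
    then obtain x where "R *v x \<noteq> 0" by (metis matrix_eq matrix_vector_mult_0)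
    then show ?thesis
      using R by (intro exI[of _ "R *v x"]) (simp add: rank_one_projector_def matrix_vector_mul_assoc)
  qed
  obtain v w where v: "v \<noteq> 0" "P *v v = v" and w: "w \<noteq> 0" "Q *v w = w"
    using eigenvector P Q by blast
  obtain \<alpha> \<beta> where \<alpha>\<beta>: "(\<alpha>, \<beta>) \<noteq> (0, 0)" and
    minors: "\<And>i j p q. (\<alpha> *s v + \<beta> *s w) $ (i, j) * (\<alpha> *s v + \<beta> *s w) $ (p, q)
      = (\<alpha> *s v + \<beta> *s w) $ (i, q) * (\<alpha> *s v + \<beta> *s w) $ (p, j)"
    using product_vector_in_plane by blast
  define x where "x = \<alpha> *s v + \<beta> *s w"
  have Rx: "R *v x = \<alpha> *s ((R ** P) *v v) + \<beta> *s ((R ** Q) *v w)" for R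
    by (simp add: x_def matrix_vector_right_distrib vector_scalar_commute v w
        flip: matrix_vector_mul_assoc)
  have "P ** P = P" "P ** Q = 0" "Q ** P = 0" "Q ** Q = Q"
    using \<P> P Q \<open>P \<noteq> Q\<close> by (auto simp: von_neumann_measurement_def rank_one_projector_def)
  \<comment> \<open>The two projectors separate the components of \<open>x\<close>, so
    \<open>x = 0\<close> would force both coefficients to vanish.\<close>
  then have "P *v x = \<alpha> *s v" "Q *v x = \<beta> *s w"
    by (simp_all add: Rx v w)
  then have "x \<noteq> 0" using \<alpha>\<beta> v w by auto
  then obtain a b c where ab: "norm a = 1" "norm b = 1"
    and \<psi>: "(\<chi> i. a $ fst i * b $ snd i) = c *\<^sub>R x"
    using minors[folded x_def] by (rule product_vector_factor)
  define \<delta> where "\<delta> = mat_tensor (outer a) (outer b)"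
  have dm: "density_matrix (outer a)" "density_matrix (outer b)"
    using ab by (simp_all add: density_matrix_outer)
  then have \<delta>: "\<delta> \<in> product_states" "density_matrix \<delta>"
    by (auto simp: \<delta>_def product_states_def density_matrix_mat_tensor)
  have zero: "outcome_prob \<delta> R = 0" if "R \<in> \<P> - {P, Q}" for R
  proof -
    have "R *v x = 0" using Rx[of R] other[of R] that by simp
    then have "R *v (c *\<^sub>R x) = 0"
      by (simp add: matrix_vector_mult_scaleR_complex)
    then show ?thesis
      by (simp add: \<delta>_def mat_tensor_outer outcome_prob_outer \<psi>)
  qed
  \<comment> \<open>Used with the identity for the total probability and with p log p for the
    entropy; both vanish at 0, the latter because the factor p annihilates the value of the total
    logarithm.\<close>
  have restrict: "(\<Sum>R\<in>\<P>. f (outcome_prob \<delta> R)) = f (outcome_prob \<delta> P) + f (outcome_prob \<delta> Q)"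
    if "f 0 = 0" for f :: "real \<Rightarrow> real"
  proof -
    have "(\<Sum>R\<in>\<P>. f (outcome_prob \<delta> R)) = (\<Sum>R\<in>{P, Q}. f (outcome_prob \<delta> R))"
      using fin P Q zero that by (intro sum.mono_neutral_right) auto
    then show ?thesis using \<open>P \<noteq> Q\<close> by simp
  qed
  have sum1: "outcome_prob \<delta> P + outcome_prob \<delta> Q = 1"
    using restrict[of "\<lambda>p. p"] measurement_outcome_prob(2)[OF \<delta>(2) \<P>] by simp
  \<comment> \<open>Binary entropy is at most 1: Jensen with equal weights compares the two
    probabilities with their mean 1/2, where p log p equals -1/2.\<close>
  have half: "(\<Sum>R\<in>{P, Q}. 1 / 2 * outcome_prob \<delta> R) = 1 / 2"
    using sum1 \<open>P \<noteq> Q\<close> by simp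
  have "(\<Sum>R\<in>{P, Q}. 1 / 2 * outcome_prob \<delta> R) * log 2 (\<Sum>R\<in>{P, Q}. 1 / 2 * outcome_prob \<delta> R)
      \<le> (\<Sum>R\<in>{P, Q}. 1 / 2 * (outcome_prob \<delta> R * log 2 (outcome_prob \<delta> R)))"
    using measurement_outcome_prob(1)[OF \<delta>(2) \<P>] P Q \<open>P \<noteq> Q\<close>
    by (intro mult_log_convex_sum) auto
  then have "- 1 \<le> outcome_prob \<delta> P * log 2 (outcome_prob \<delta> P)
      + outcome_prob \<delta> Q * log 2 (outcome_prob \<delta> Q)"
    unfolding half using \<open>P \<noteq> Q\<close> by (simp add: log_divide)
  then have "klein_entropy \<delta> \<P> \<le> 1"
    using restrict[of "\<lambda>p. p * log 2 p"] by (simp add: klein_entropy_def)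
  with \<delta> that show ?thesis by blast
qed

theorem proposition5:
  fixes \<rho> :: "complex^(2 \<times> 2)^(2 \<times> 2)"
  assumes "density_matrix \<rho>"
  shows "entropic_entanglement \<rho> \<le> 1 - von_neumann_entropy \<rho>"
  unfolding entropic_entanglement_def
proof (rule cSUP_least)
  show "{\<P> :: (complex^(2 \<times> 2)^(2 \<times> 2)) set. von_neumann_measurement \<P>} \<noteq> {}"
    using von_neumann_measurement_exists by blast
next
  fix \<P> :: "(complex^(2 \<times> 2)^(2 \<times> 2)) set"
  assume "\<P> \<in> {\<P>. von_neumann_measurement \<P>}"
  then have \<P>: "von_neumann_measurement \<P>" by simp
  obtain \<delta> where \<delta>: "\<delta> \<in> product_states" "klein_entropy \<delta> \<P> \<le> 1"
    using product_state_klein_entropy_le_1[OF \<P>] by blast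
  \<comment> \<open>A real infimum lies below a given member only when the set is bounded below;
    nonnegativity of Klein entropy provides the bound.\<close>
  have "bdd_below ((\<lambda>\<delta>. klein_entropy \<delta> \<P>) ` product_states)"
    using klein_entropy_nonneg[OF _ \<P>] density_matrix_mat_tensor
    by (intro bdd_belowI2[of _ 0]) (auto simp: product_states_def)
  then have "(INF \<delta>\<in>product_states. klein_entropy \<delta> \<P>) \<le> 1"
    using \<delta> by (rule cINF_lower2)
  then show "(INF \<delta>\<in>product_states. klein_entropy \<delta> \<P>) - klein_entropy \<rho> \<P>
      \<le> 1 - von_neumann_entropy \<rho>"
    using von_neumann_entropy_le_klein_entropy[OF assms \<P>] by simp
qed

end
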